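(* Let $(S,d)$ be a bounded metric space with more than one point. Then $(S,d)$ admits a visual approximation (of some width $w\in\mathbb{N}_0$ and with some visual parameter $\Lambda>1$) if and only if $(S,d)$ is uniformly perfect.
   Context: $\mathbb{N}_0=\{0,1,2,\dots\}$. A metric space $(S,d)$ is uniformly perfect if there is $\lambda\in(0,1)$ such that $B(x,r)\setminus\overline{B(x,\lambda r)}\neq\emptyset$ for all $x\in S$ and all $0<r\le \operatorname{diam}(S)$, where $B(x,r)=\{y: d(x,y)<r\}$. Let $\{\mathbf{X}^n\}_{n\in\mathbb{N}_0}$ be a sequence of covers of $S$ (each $\mathbf{X}^n$ is a collection, possibly infinite, of subsets of $S$ whose union is $S$). Elements of $\mathbf{X}^n$ are called $n$-tiles. For $X,Y\in\mathbf{X}^n$, a chain of $n$-tiles of length $k$ from $X$ to $Y$ is a finite sequence $X_0=X,X_1,\dots,X_k=Y$ of $n$-tiles with $X_j\cap X_{j+1}\ne\emptyset$ for $j=0,\dots,k-1$. For $w\in\mathbb{N}_0$ and $X\in\mathbf{X}^n$, $U_w(X)$ is the union of all $Y\in\mathbf{X}^n$ for which there is a chain of $n$-tiles from $X$ to $Y$ of length $\le w$; in particular $U_0(X)=X$. For $\Lambda>1$ and $w\in\mathbb{N}_0$, a visual approximation of width $w$ with visual parameter $\Lambda$ for $(S,d)$ is a sequence $\{\mathbf{X}^n\}_{n\in\mathbb{N}_0}$ of covers of $S$ with $\mathbf{X}^0=\{S\}$ for which there is a constant $C\ge 1$ such that for all $n\in\mathbb{N}_0$ and $X,Y\in\mathbf{X}^n$: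 (i) $\frac1C\Lambda^{-n}\le\operatorname{diam}(X)\le C\Lambda^{-n}$; (ii) $\operatorname{dist}(X,Y)\ge\frac1C\Lambda^{-n}$ whenever $U_w(X)\cap U_w(Y)=\emptyset$. Here $\operatorname{dist}(X,Y)=\inf\{d(x,y):x\in X,\,y\in Y\}$. *)

theory Defs
  imports "HOL-Analysis.Analysis"
begin

(* A metric space (S, d) is a set S in a type of class metric_space, with the metric dist
   restricted to S.  Balls of the space S are the sets ball x r \<inter> S; closures are taken in the
   ambient type, which makes no difference for set differences of subsets of S. *)

(* diameter is a supremum of reals and is unspecified for unbounded sets; diam(S) is infinite
   there, hence the guard on r \<le> diameter S. *)
definition uniformly_perfect :: "'a::metric_space set \<Rightarrow> bool" where
  "uniformly_perfect S \<longleftrightarrow>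
     (\<exists>c::real. 0 < c \<and> c < 1 \<and>
        (\<forall>x\<in>S. \<forall>r>0. (bounded S \<longrightarrow> r \<le> diameter S) \<longrightarrow>
           (ball x r \<inter> S) - closure (ball x (c * r) \<inter> S) \<noteq> {}))"

definition tile_chain ::
  "'a set set \<Rightarrow> nat \<Rightarrow> (nat \<Rightarrow> 'a set) \<Rightarrow> 'a set \<Rightarrow> 'a set \<Rightarrow> bool" where
  "tile_chain T k Z X Y \<longleftrightarrow>
     Z 0 = X \<and> Z k = Y \<and> (\<forall>j\<le>k. Z j \<in> T) \<and> (\<forall>j<k. Z j \<inter> Z (Suc j) \<noteq> {})"

(* U_w(X), relative to the collection T of tiles of the level under consideration *)
definition tile_nbhd :: "'a set set \<Rightarrow> nat \<Rightarrow> 'a set \<Rightarrow> 'a set" where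
  "tile_nbhd T w X = \<Union>{Y \<in> T. \<exists>k\<le>w. \<exists>Z. tile_chain T k Z X Y}"

(* The conjunct bounded A expresses that diam(A) is finite. *)
definition visual_approximation ::
  "'a::metric_space set \<Rightarrow> nat \<Rightarrow> real \<Rightarrow> (nat \<Rightarrow> 'a set set) \<Rightarrow> bool" where
  "visual_approximation S w \<Lambda> \<X> \<longleftrightarrow>
     1 < \<Lambda> \<and> (\<forall>n. \<Union>(\<X> n) = S) \<and> \<X> 0 = {S} \<and>
     (\<exists>C\<ge>1. \<forall>n.
        (\<forall>A\<in>\<X> n. bounded A \<and> 1 / C * \<Lambda> powi (- int n) \<le> diameter A \<and>
                   diameter A \<le> C * \<Lambda> powi (- int n)) \<and>
        (\<forall>A\<in>\<X> n. \<forall>B\<in>\<X> n. tile_nbhd (\<X> n) w A \<inter> tile_nbhd (\<X> n) w B = {} \<longrightarrow>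
                   1 / C * \<Lambda> powi (- int n) \<le> setdist A B))"

end

theory Submission
  imports Defs
begin

text \<open>
  Both conditions say that \<open>S\<close> has, around each of its points and at each scale below its
  diameter, a subset whose diameter is comparable to that scale.

  Given a visual approximation, the tiles containing a point \<open>x\<close> have diameters comparable to
  \<open>\<Lambda>\<close> to the power \<open>-n\<close>. For a radius \<open>r\<close>, the first level at which such a tile must fit into the
  ball of radius \<open>r\<close> still has tiles of diameter comparable to \<open>r\<close>, because the previous level
  was too coarse; hence the tile has a point at distance comparable to \<open>r\<close> from \<open>x\<close>
  (\<open>visual_approximation_imp_uniformly_perfect\<close>).

  Conversely, covers may be infinite, so no nets or separated subsets have to be chosen: the
  \<open>n\<close>-tiles are simply \<^emph>\<open>all\<close> balls of one radius proportional to \<open>2\<close> to the power \<open>-n\<close>. Uniform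
  perfectness gives the lower bound on their diameters. The separation condition holds with
  width 1: if points \<open>a\<close> and \<open>b\<close> of two tiles are closer than the radius, then the ball
  centred at \<open>a\<close> is itself a tile that meets both
  (\<open>uniformly_perfect_imp_visual_approximation\<close>).
\<close>

lemma diameter_le_metric:
  fixes A :: "'a::metric_space set"
  assumes "0 \<le> d" "\<And>y z. \<lbrakk>y \<in> A; z \<in> A\<rbrakk> \<Longrightarrow> dist y z \<le> d"
  shows "diameter A \<le> d"
  using assms by (auto simp: diameter_def intro!: cSUP_least)

text \<open>Otherwise the closed ball of radius \<open>s\<close> about \<open>x\<close> would contain \<open>A\<close>, and its diameter is at
  most \<open>2 * s\<close>.\<close>

lemma exists_point_far_from:
  fixes A :: "'a::metric_space set"
  assumes "0 \<le> s" "2 * s < diameter A"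
  shows "\<exists>y\<in>A. s < dist x y"
proof (rule ccontr)
  assume "\<not> ?thesis"
  then have near: "dist x y \<le> s" if "y \<in> A" for y
    using that by (simp add: not_less Bex_def)
  have "diameter A \<le> 2 * s"
  proof (rule diameter_le_metric)
    show "0 \<le> 2 * s" using assms by simp
    show "dist y z \<le> 2 * s" if "y \<in> A" "z \<in> A" for y z
      using near[OF that(1)] near[OF that(2)] dist_triangle3[of y z x] by linarith
  qed
  with assms show False by simp
qed

lemma uniformly_perfect_if_annuli_nonempty:
  fixes S :: "'a::metric_space set"
  assumes "bounded S" "0 < c" "c < 1"
    and annulus: "\<And>x r. \<lbrakk>x \<in> S; 0 < r; r \<le> diameter S\<rbrakk> \<Longrightarrow> \<exists>y\<in>S. c * r < dist x y \<and> dist x y < r"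
  shows "uniformly_perfect S"
  unfolding uniformly_perfect_def
proof (intro exI[of _ c] conjI ballI allI impI)
  fix x r assume "x \<in> S" "(0::real) < r" "bounded S \<longrightarrow> r \<le> diameter S"
  then obtain y where "y \<in> S" and far: "c * r < dist x y" and "dist x y < r"
    using annulus assms(1) by blast
  moreover have "closure (ball x (c * r) \<inter> S) \<subseteq> cball x (c * r)"
    by (intro closure_minimal) auto
  ultimately show "ball x r \<inter> S - closure (ball x (c * r) \<inter> S) \<noteq> {}"
    by force
qed (use assms in auto)

lemma visual_approximation_imp_uniformly_perfect:
  fixes S :: "'a::metric_space set"
  assumes "bounded S" and vis: "visual_approximation S w \<Lambda> \<X>"
  shows "uniformly_perfect S"
proof -
  have "1 < \<Lambda>" and cover: "\<Union>(\<X> n) = S" and level_0: "\<X> 0 = {S}" for n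
    using vis by (simp_all add: visual_approximation_def)
  obtain C where "1 \<le> C" and tiles: "\<forall>n. \<forall>A\<in>\<X> n. bounded A \<and>
      1 / C * \<Lambda> powi (- int n) \<le> diameter A \<and> diameter A \<le> C * \<Lambda> powi (- int n)"
    using vis unfolding visual_approximation_def by (elim conjE exE) auto
  have tile_bounded: "bounded A"
    and diam_lower: "1 / C * \<Lambda> powi (- int n) \<le> diameter A"
    and diam_upper: "diameter A \<le> C * \<Lambda> powi (- int n)" if "A \<in> \<X> n" for n A
    using tiles that by blast+
  \<comment> \<open>A factor \<open>C * \<Lambda>\<close> is lost in the choice of the level, a factor \<open>C\<close> in the lower bound on tile
    diameters, and a factor of more than 2 because \<open>x\<close> may lie anywhere in its tile.\<close>
  define c where "c = 1 / (3 * C * C * \<Lambda>)"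
  have "1 < C * C * \<Lambda>"
    using \<open>1 < \<Lambda>\<close> \<open>1 \<le> C\<close> by (metis less_1_mult mult_1 less_eq_real_def)
  then have "0 < c" "c < 1"
    by (auto simp: c_def)
  show ?thesis
  proof (rule uniformly_perfect_if_annuli_nonempty[OF \<open>bounded S\<close> \<open>0 < c\<close> \<open>c < 1\<close>])
    fix x r assume "x \<in> S" "(0::real) < r" "r \<le> diameter S"
    define scale where "scale n = \<Lambda> powi (- int n)" for n
    have scale_power: "scale n = (1 / \<Lambda>) ^ n" for n
      by (simp add: scale_def power_int_minus power_one_over inverse_eq_divide)
    have fits: "\<exists>n. C * scale n < r"
    proof -
      obtain n where "(1 / \<Lambda>) ^ n < r / C"
        using real_arch_pow_inv[of "r / C" "1 / \<Lambda>"] \<open>0 < r\<close> \<open>1 \<le> C\<close> \<open>1 < \<Lambda>\<close> by auto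
      then show ?thesis
        using \<open>1 \<le> C\<close> by (auto simp: scale_power field_simps)
    qed
    have "\<not> C * scale 0 < r"
      using diam_upper[of S 0] level_0 \<open>r \<le> diameter S\<close> by (simp add: scale_def)
    with fits obtain m where too_coarse: "r \<le> C * scale m" and fine: "C * scale (Suc m) < r"
      using exists_least_lemma[of "\<lambda>n. C * scale n < r"] by force
    have comparable: "r \<le> C * \<Lambda> * scale (Suc m)"
      using too_coarse \<open>1 < \<Lambda>\<close> by (simp add: scale_power)
    obtain A where A: "A \<in> \<X> (Suc m)" "x \<in> A" "A \<subseteq> S"
      using cover[of "Suc m"] \<open>x \<in> S\<close> by blast
    have "2 * (c * r) < 3 * (c * r)"
      using \<open>0 < c\<close> \<open>0 < r\<close> by simp
    also have "\<dots> = r / (C * \<Lambda>) / C"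
      using \<open>1 \<le> C\<close> by (simp add: c_def field_simps)
    also have "\<dots> \<le> scale (Suc m) / C"
      using comparable \<open>1 \<le> C\<close> \<open>1 < \<Lambda>\<close>
      by (intro divide_right_mono) (simp_all add: divide_le_eq mult.commute)
    also have "\<dots> \<le> diameter A"
      using diam_lower[OF A(1)] by (simp add: scale_def)
    finally obtain y where y: "y \<in> A" "c * r < dist x y"
      using exists_point_far_from[of "c * r" A x] \<open>0 < c\<close> \<open>0 < r\<close> by auto
    have "dist x y \<le> diameter A"
      using tile_bounded[OF A(1)] A(2) y(1) by (rule diameter_bounded_bound)
    also have "\<dots> < r"
      using diam_upper[OF A(1)] fine by (simp add: scale_def)
    finally show "\<exists>y\<in>S. c * r < dist x y \<and> dist x y < r"
      using y A(3) by blast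
  qed
qed

lemma diameter_ball_Int_le:
  fixes S :: "'a::metric_space set"
  assumes "0 \<le> r"
  shows "diameter (ball x r \<inter> S) \<le> 2 * r"
proof (rule diameter_le_metric)
  show "0 \<le> 2 * r" using assms by simp
  show "dist y z \<le> 2 * r" if "y \<in> ball x r \<inter> S" "z \<in> ball x r \<inter> S" for y z
    using that dist_triangle3[of y z x] by simp
qed

lemma tile_nbhd_1_containing:
  assumes "A \<in> T" "B \<in> T" "A \<inter> B \<noteq> {}"
  shows "B \<subseteq> tile_nbhd T 1 A"
proof -
  have "tile_chain T 1 (\<lambda>j. if j = 0 then A else B) A B"
    using assms by (auto simp: tile_chain_def)
  then show ?thesis
    using assms(2) unfolding tile_nbhd_def by blast
qed

text \<open>
  Two points at distance less than \<open>r\<close> lie in a common tile, so the balls of a fixed radius form a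
  cover that is separated with width 1.
\<close>

lemma setdist_balls_ge_if_tile_nbhds_disjoint:
  fixes S :: "'a::metric_space set"
  assumes T: "T = (\<lambda>x. ball x r \<inter> S) ` S" and "0 < r"
    and "A \<in> T" "B \<in> T" and disjoint: "tile_nbhd T 1 A \<inter> tile_nbhd T 1 B = {}"
  shows "r \<le> setdist A B"
proof (rule le_setdistI)
  show "A \<noteq> {}" "B \<noteq> {}"
    using \<open>A \<in> T\<close> \<open>B \<in> T\<close> \<open>0 < r\<close> by (force simp: T)+
  fix a b assume ab: "a \<in> A" "b \<in> B"
  show "r \<le> dist a b"
  proof (rule ccontr)
    assume close: "\<not> r \<le> dist a b"
    define M where "M = ball a r \<inter> S"
    have "a \<in> S" "b \<in> S"
      using ab \<open>A \<in> T\<close> \<open>B \<in> T\<close> T by auto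
    then have "M \<in> T" "a \<in> M" "b \<in> M"
      using close \<open>0 < r\<close> T by (auto simp: M_def)
    then have "M \<subseteq> tile_nbhd T 1 A" "M \<subseteq> tile_nbhd T 1 B"
      using ab \<open>A \<in> T\<close> \<open>B \<in> T\<close> by (intro tile_nbhd_1_containing; blast)+
    with disjoint \<open>a \<in> M\<close> show False by blast
  qed
qed

lemma diameter_ball_ge_if_annulus_nonempty:
  fixes S :: "'a::metric_space set"
  assumes "x \<in> S" "0 < r" "r \<le> R"
    and annulus: "ball x r \<inter> S - closure (ball x (c * r) \<inter> S) \<noteq> {}"
  shows "c * r \<le> diameter (ball x R \<inter> S)"
proof -
  from annulus obtain y where y: "y \<in> ball x r \<inter> S" "y \<notin> closure (ball x (c * r) \<inter> S)"
    by blast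
  then have "y \<notin> ball x (c * r)"
    using closure_subset[of "ball x (c * r) \<inter> S"] by blast
  then have "c * r \<le> dist x y"
    by simp
  also have "\<dots> \<le> diameter (ball x R \<inter> S)"
    using assms(1-3) y by (intro diameter_bounded_bound) auto
  finally show ?thesis .
qed

lemma uniformly_perfect_imp_visual_approximation:
  fixes S :: "'a::metric_space set"
  assumes "bounded S" and "\<exists>x\<in>S. \<exists>y\<in>S. x \<noteq> y" and "uniformly_perfect S"
  shows "\<exists>\<X>. visual_approximation S 1 2 \<X>"
proof -
  define D where "D = diameter S"
  from assms(2) have "0 < D"
    unfolding D_def using diameter_bounded_bound[OF \<open>bounded S\<close>]
    by (metis dist_pos_lt less_le_trans)
  obtain c where "0 < c" "c < 1" and annulus: "\<forall>x\<in>S. \<forall>r>0. r \<le> D \<longrightarrow>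
      ball x r \<inter> S - closure (ball x (c * r) \<inter> S) \<noteq> {}"
    using \<open>uniformly_perfect S\<close> \<open>bounded S\<close>
    unfolding uniformly_perfect_def D_def by (elim exE conjE) simp
  define scale :: "nat \<Rightarrow> real" where "scale n = 2 powi (- int n)" for n
  have scale: "0 < scale n" "scale n \<le> 1" for n
    by (simp_all add: scale_def power_int_minus inverse_le_1_iff)
  \<comment> \<open>With radius \<open>2 * D\<close> at level 0, every ball is all of \<open>S\<close>, even when \<open>S\<close> has two points at
    distance \<open>D\<close>. Uniform perfectness is available only for radii up to \<open>D\<close>, so it is applied to
    the balls of half the radius.\<close>
  define \<X> where "\<X> n = (\<lambda>x. ball x (2 * D * scale n) \<inter> S) ` S" for n
  define C where "C = Max {1, 4 * D, 1 / (c * D)}"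
  have C: "1 \<le> C" "4 * D \<le> C" "1 / (c * D) \<le> C"
    by (simp_all add: C_def)
  have inv_C: "1 / C \<le> c * D"
    using C(1,3) \<open>0 < c\<close> \<open>0 < D\<close> by (simp add: field_simps)
  have "ball x (2 * D) \<inter> S = S" if "x \<in> S" for x
    using diameter_bounded_bound[OF \<open>bounded S\<close> that] \<open>0 < D\<close> by (force simp: D_def)
  then have level_0: "\<X> 0 = {S}"
    using assms(2) by (auto simp: \<X>_def scale_def)
  have cover: "\<Union>(\<X> n) = S" for n
    using \<open>0 < D\<close> scale(1)[of n] by (force simp: \<X>_def)
  have diam: "bounded A \<and> 1 / C * scale n \<le> diameter A \<and> diameter A \<le> C * scale n"
    if A_in: "A \<in> \<X> n" for A n
  proof (intro conjI)
    obtain x where "x \<in> S" and A: "A = ball x (2 * D * scale n) \<inter> S"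
      using A_in by (auto simp: \<X>_def)
    show "bounded A"
      using \<open>bounded S\<close> unfolding A by (rule bounded_subset) simp
    have "1 / C * scale n \<le> c * D * scale n"
      using inv_C scale(1)[of n] by (intro mult_right_mono) auto
    also have "\<dots> = c * (D * scale n)"
      by simp
    also have "\<dots> \<le> diameter A"
      unfolding A using \<open>0 < D\<close> scale[of n] \<open>x \<in> S\<close>
      by (intro diameter_ball_ge_if_annulus_nonempty[where r = "D * scale n"] annulus[rule_format])
         (auto simp: mult_left_le)
    finally show "1 / C * scale n \<le> diameter A" .
    have "diameter A \<le> 4 * D * scale n"
      using diameter_ball_Int_le[of "2 * D * scale n" x S] \<open>0 < D\<close> scale(1)[of n] by (simp add: A)
    also have "\<dots> \<le> C * scale n"
      using C(2) scale(1)[of n] by (intro mult_right_mono) auto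
    finally show "diameter A \<le> C * scale n" .
  qed
  have separated: "1 / C * scale n \<le> setdist A B"
    if "A \<in> \<X> n" "B \<in> \<X> n" "tile_nbhd (\<X> n) 1 A \<inter> tile_nbhd (\<X> n) 1 B = {}" for A B n
  proof -
    have "c * D \<le> 2 * D"
      using \<open>c < 1\<close> \<open>0 < D\<close> by simp
    then have "1 / C * scale n \<le> 2 * D * scale n"
      using inv_C scale(1)[of n] by (intro mult_right_mono) auto
    also have "\<dots> \<le> setdist A B"
      using setdist_balls_ge_if_tile_nbhds_disjoint[OF \<X>_def _ that] \<open>0 < D\<close> scale(1)[of n] by simp
    finally show ?thesis .
  qed
  have "visual_approximation S 1 2 \<X>"
    unfolding visual_approximation_def scale_def[symmetric]
    using level_0 cover diam separated C(1) by (intro conjI exI[of _ C]) auto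
  then show ?thesis by blast
qed

theorem proposition3p4:
  fixes S :: "'a::metric_space set"
  assumes "bounded S"
    and "\<exists>x\<in>S. \<exists>y\<in>S. x \<noteq> y"
  shows "(\<exists>w \<Lambda> \<X>. visual_approximation S w \<Lambda> \<X>) \<longleftrightarrow> uniformly_perfect S"
  using visual_approximation_imp_uniformly_perfect[OF assms(1)]
    uniformly_perfect_imp_visual_approximation[OF assms] by blast

end
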